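(* Let $\{A_n\}_{n\in\mathbb{Z}}$ be any sequence of complex numbers and let $x,b,t$ be complex numbers such that the infinite series below converge absolutely. Then $$\sum_{i, j \geq 0} \frac{A_{i-j}\, q^{ij} x^j}{(q ; q)_{i}(q ; q)_j}\frac{(bq^{-i}, t ; q)_{j}}{(bt; q)_{j}}=\sum_{i, j, k \geq 0} \frac{A_{i-j}\, q^{k(k-1)/2}(-1)^{k}x^{j+k}}{(q ; q)_i(q ; q)_j(q ; q)_k}\frac{(tq^{i+k},b;q)_j}{(bt;q)_j}.$$
   Context: $q$ is a complex number with $0<|q|<1$. Notation: $(a;q)_\infty=\prod_{k\ge 0}(1-aq^k)$ and $(a;q)_n=(a;q)_\infty/(aq^n;q)_\infty$ for $n\in\mathbb{Z}$, i.e. $(a;q)_n=\prod_{k=0}^{n-1}(1-aq^k)$ for $n\ge 0$; and $(a_1,\ldots,a_m;q)_n=\prod_{k=1}^m (a_k;q)_n$. All parameters are assumed to be such that no zero factors occur in denominators. *)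

theory Defs
  imports Complex_Main "HOL-Analysis.Infinite_Sum"
begin

text \<open>The finite \<open>q\<close>-shifted factorial \<open>(a; q)\<^sub>n\<close> for \<open>n \<ge> 0\<close>. The product form is used
  rather than the quotient \<open>(a; q)\<^sub>\<infinity> / (a q\<^sup>n; q)\<^sub>\<infinity>\<close>, as the latter reads \<open>0 / 0\<close>
  when \<open>a q\<^sup>m = 1\<close> for some \<open>m \<ge> n\<close>.\<close>

definition qpoch :: "complex \<Rightarrow> complex \<Rightarrow> nat \<Rightarrow> complex" where
  "qpoch a q n = (\<Prod>k<n. 1 - a * q ^ k)"

end

theory Submission
  imports Defs
begin

text \<open>
  Both sides are power series in \<open>x\<close>, linear in the \<open>A\<close>'s, so it is enough to compare the factors
  that multiply \<open>A\<^bsub>N - m\<^esub> x\<^sup>m\<close>. Setting \<open>N = i + k\<close> and \<open>m = j + k\<close> in the triple series leaves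
  \<open>i - j = N - m\<close> and \<open>x\<^bsup>j + k\<^esup> = x\<^sup>m\<close> free of \<open>k\<close>, and for given \<open>(N, m)\<close> only the finitely many
  \<open>k \<le> min N m\<close> occur; absolute convergence permits this regrouping (\<open>infsum_by_diagonals\<close>).
  The double series has a single term with \<open>(i, j) = (N, m)\<close>, so the theorem becomes the finite
  identity \<open>saalschuetz_coefficient\<close>.

  Read with \<open>m - k\<close> as summation index, that finite sum is a balanced terminating
  \<open>\<^sub>3\<phi>\<^sub>2(t q\<^sup>N, b, q\<^bsup>-m\<^esup>; b t, q\<^bsup>N - m + 1\<^esup>; q, q)\<close>, and its evaluation is the \<open>q\<close>-Pfaff--Saalschuetz
  sum. The classical form has zero factors in denominators when \<open>N < m\<close>. Clearing them and replacing
  \<open>q\<^sup>N\<close> by a free variable \<open>y\<close> gives an identity polynomial in \<open>y\<close>, \<open>b\<close> and \<open>t\<close>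
  (\<open>q_saalschuetz\<close>), which is proved by induction on \<open>m\<close> just as the binomial theorem
  follows from Pascal's rule: going from \<open>m\<close> to \<open>m + 1\<close> multiplies the right-hand side by a factor
  whose product with each summand splits into two pieces, and pieces of neighbouring summands combine
  to the summands for \<open>m + 1\<close>.
\<close>

section \<open>Finite q-shifted factorials\<close>

lemma qpoch_0 [simp]: "qpoch a q 0 = 1"
  by (simp add: qpoch_def)

lemma qpoch_Suc: "qpoch a q (Suc n) = qpoch a q n * (1 - a * q ^ n)"
  by (simp add: qpoch_def)

lemma qpoch_Suc_shift: "qpoch a q (Suc n) = (1 - a) * qpoch (a * q) q n"
  by (simp add: qpoch_def prod.lessThan_Suc_shift mult.assoc del: prod.lessThan_Suc)

lemma qpoch_add: "qpoch a q (m + n) = qpoch a q m * qpoch (a * q ^ m) q n"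
  by (induction n) (simp_all add: qpoch_Suc power_add mult.assoc)

lemma qpoch_q_nonzero:
  assumes "\<And>n. n > 0 \<Longrightarrow> q ^ n \<noteq> 1"
  shows "qpoch q q n \<noteq> 0"
proof -
  have "1 - q * q ^ k \<noteq> 0" for k
    using assms[of "Suc k"] by simp
  then show ?thesis
    by (simp add: qpoch_def)
qed

section \<open>The q-Pfaff--Saalschuetz sum in polynomial form\<close>

text \<open>
  The factor of \<open>A\<^bsub>N - m\<^esub> x\<^sup>m\<close> in the term of the triple series with \<open>k = e\<close> and \<open>m = j + e\<close>,
  multiplied by \<open>(q; q)\<^sub>N (b t; q)\<^sub>m\<close> and with \<open>y\<close> in place of \<open>q\<^sup>N\<close>. Having both \<open>j\<close> and
  \<open>e = m - j\<close> as arguments keeps the recurrences free of subtraction.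
\<close>

definition saal_term :: "complex \<Rightarrow> complex \<Rightarrow> complex \<Rightarrow> complex \<Rightarrow> nat \<Rightarrow> nat \<Rightarrow> complex" where
  "saal_term q b t y j e = qpoch (t * y) q j * qpoch b q j * qpoch (b * t * q ^ j) q e * (\<Prod>l<e. y - q ^ l)
     / (qpoch q q j * qpoch q q e)"

text \<open>
  The two pieces into which a summand for \<open>m = j + e\<close> splits when \<open>m\<close> grows by one: the first
  goes into the summand with the same \<open>j\<close>, the second into the one with \<open>j + 1\<close>. They are
  read off from the telescoping certificate that creative telescoping yields for this sum.
\<close>

definition saal_stay :: "complex \<Rightarrow> complex \<Rightarrow> complex \<Rightarrow> complex \<Rightarrow> nat \<Rightarrow> nat \<Rightarrow> complex" where
  "saal_stay q b t y j e =
     saal_term q b t y j e * (y - q ^ e) * (1 - b * t * q ^ (2 * j + e)) / (1 - q ^ Suc (j + e))"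

definition saal_move :: "complex \<Rightarrow> complex \<Rightarrow> complex \<Rightarrow> complex \<Rightarrow> nat \<Rightarrow> nat \<Rightarrow> complex" where
  "saal_move q b t y j e =
     saal_term q b t y j e * q ^ e * (1 - b * q ^ j) * (1 - t * y * q ^ j) / (1 - q ^ Suc (j + e))"

text \<open>
  The factor on the left is the quotient of the closed forms for \<open>m + 1\<close> and \<open>m\<close>, where
  \<open>m = j + e\<close>.
\<close>

lemma saal_split:
  "saal_term q b t y j e * ((y - b * q ^ (j + e)) * (1 - t * q ^ (j + e)) / (1 - q ^ Suc (j + e)))
     = saal_stay q b t y j e + saal_move q b t y j e"
proof -
  have "(y - b * q ^ (j + e)) * (1 - t * q ^ (j + e))
      = (y - q ^ e) * (1 - b * t * q ^ (2 * j + e)) + q ^ e * (1 - b * q ^ j) * (1 - t * y * q ^ j)"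
    by (simp add: power_add power_mult power2_eq_square mult_2 algebra_simps)
  then show ?thesis
    unfolding saal_stay_def saal_move_def
    by (simp only: add_divide_distrib[symmetric] distrib_left[symmetric] times_divide_eq_right mult.assoc)
qed

text \<open>
  The extreme summands \<open>j = 0\<close> and \<open>j = m + 1\<close> receive only one piece each.
\<close>

lemma saal_first: "saal_term q b t y 0 (Suc e) = saal_stay q b t y 0 e"
  by (simp add: saal_term_def saal_stay_def qpoch_Suc mult_ac)

lemma saal_last: "saal_term q b t y (Suc j) 0 = saal_move q b t y j 0"
  by (simp add: saal_term_def saal_move_def qpoch_Suc mult_ac)

text \<open>
  All three terms are multiples of one product \<open>C\<close>; what remains after cancelling is a
  refinement of Pascal's rule for Gaussian binomials, to which it reduces at \<open>b t = 0\<close>.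
\<close>

lemma saal_pascal:
  assumes nr: "\<And>n. n > 0 \<Longrightarrow> q ^ n \<noteq> 1"
  shows "saal_term q b t y (Suc j) (Suc e) = saal_stay q b t y (Suc j) e + saal_move q b t y j (Suc e)"
proof -
  \<comment> \<open>\<open>C\<close> starts the factorial in \<open>b * t\<close> one step later than \<open>saal_term q b t y j e\<close> does.
      Thus it divides \<open>saal_term q b t y (Suc j) e\<close> too, also when \<open>b * t * q ^ j = 1\<close>.\<close>
  define C where "C = qpoch (t * y) q j * qpoch b q j * qpoch (b * t * q ^ Suc j) q e
    * (\<Prod>l<e. y - q ^ l) / (qpoch q q j * qpoch q q e)"
  define J E M where "J = 1 - q ^ Suc j" and "E = 1 - q ^ Suc e" and "M = 1 - q ^ Suc (Suc (j + e))"
  have nz: "J \<noteq> 0" "E \<noteq> 0" "M \<noteq> 0"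
    using nr[of "Suc j"] nr[of "Suc e"] nr[of "Suc (Suc (j + e))"] by (simp_all add: J_def E_def M_def)
  have shift: "qpoch (b * t * q ^ j) q (Suc e) = (1 - b * t * q ^ j) * qpoch (b * t * q ^ Suc j) q e"
    using qpoch_Suc_shift[of "b * t * q ^ j" q e] by (simp add: mult_ac)
  have w10: "saal_term q b t y (Suc j) e = C * ((1 - t * y * q ^ j) * (1 - b * q ^ j)) / J"
    by (simp add: saal_term_def C_def J_def qpoch_Suc mult_ac)
  have w01: "saal_term q b t y j (Suc e) = C * ((1 - b * t * q ^ j) * (y - q ^ e)) / E"
    unfolding saal_term_def C_def E_def shift by (simp add: qpoch_Suc mult_ac)
  have w11: "saal_term q b t y (Suc j) (Suc e)
      = C * ((1 - t * y * q ^ j) * (1 - b * q ^ j) * (1 - b * t * q ^ (Suc j + e)) * (y - q ^ e)) / (J * E)"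
    by (simp add: saal_term_def C_def J_def E_def qpoch_Suc power_add mult_ac)
  have key: "(1 - b * t * q ^ (Suc j + e)) * M
      = (1 - b * t * q ^ (2 * Suc j + e)) * E + q ^ Suc e * (1 - b * t * q ^ j) * J"
    by (simp add: J_def E_def M_def power_add mult_2 mult_2_right algebra_simps)
  define X where "X = C * ((1 - t * y * q ^ j) * (1 - b * q ^ j) * (y - q ^ e)) / (J * E * M)"
  have "saal_term q b t y (Suc j) (Suc e) = X * ((1 - b * t * q ^ (Suc j + e)) * M)"
    using nz by (simp add: w11 X_def)
  also have "\<dots> = X * ((1 - b * t * q ^ (2 * Suc j + e)) * E) + X * (q ^ Suc e * (1 - b * t * q ^ j) * J)"
    by (simp only: key distrib_left)
  also have "X * ((1 - b * t * q ^ (2 * Suc j + e)) * E) = saal_stay q b t y (Suc j) e"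
    using nz by (simp add: saal_stay_def w10 X_def M_def)
  also have "X * (q ^ Suc e * (1 - b * t * q ^ j) * J) = saal_move q b t y j (Suc e)"
    using nz by (simp add: saal_move_def w01 X_def M_def)
  finally show ?thesis .
qed

lemma q_saalschuetz:
  assumes nr: "\<And>n. n > 0 \<Longrightarrow> q ^ n \<noteq> 1"
  shows "(\<Sum>j\<le>m. saal_term q b t y j (m - j)) = (\<Prod>l<m. y - b * q ^ l) * qpoch t q m / qpoch q q m"
proof (induction m)
  case 0
  then show ?case by (simp add: saal_term_def)
next
  case (Suc m)
  let ?w = "saal_term q b t y" and ?a = "saal_stay q b t y" and ?b = "saal_move q b t y"
  let ?c = "(y - b * q ^ m) * (1 - t * q ^ m) / (1 - q ^ Suc m)"
  have "(\<Sum>j\<le>Suc m. ?w j (Suc m - j))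
      = ?w 0 (Suc m) + (\<Sum>j<m. ?w (Suc j) (m - j)) + ?w (Suc m) 0"
    by (simp add: sum.atMost_shift)
  also have "(\<Sum>j<m. ?w (Suc j) (m - j)) = (\<Sum>j<m. ?a (Suc j) (m - Suc j) + ?b j (m - j))"
  proof (rule sum.cong)
    fix j assume "j \<in> {..<m}"
    then have "m - j = Suc (m - Suc j)" by auto
    then show "?w (Suc j) (m - j) = ?a (Suc j) (m - Suc j) + ?b j (m - j)"
      using saal_pascal[OF nr] by metis
  qed simp
  also have "?w 0 (Suc m) + (\<Sum>j<m. ?a (Suc j) (m - Suc j) + ?b j (m - j)) + ?w (Suc m) 0
      = (?a 0 m + (\<Sum>j<m. ?a (Suc j) (m - Suc j))) + ((\<Sum>j<m. ?b j (m - j)) + ?b m 0)"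
    by (simp add: sum.distrib saal_first saal_last)
  also have "\<dots> = (\<Sum>j\<le>m. ?a j (m - j)) + (\<Sum>j\<le>m. ?b j (m - j))"
    using sum.atMost_shift[of "\<lambda>j. ?a j (m - j)" m] by (simp flip: lessThan_Suc_atMost)
  also have "\<dots> = (\<Sum>j\<le>m. ?w j (m - j) * ?c)"
    unfolding sum.distrib[symmetric]
  proof (rule sum.cong)
    fix j assume "j \<in> {..m}"
    then show "?a j (m - j) + ?b j (m - j) = ?w j (m - j) * ?c"
      using saal_split[of q b t y j "m - j"] by simp
  qed simp
  also have "\<dots> = (\<Prod>l<m. y - b * q ^ l) * qpoch t q m / qpoch q q m * ?c"
    by (simp only: Suc.IH sum_distrib_right[symmetric])
  also have "\<dots> = (\<Prod>l<Suc m. y - b * q ^ l) * qpoch t q (Suc m) / qpoch q q (Suc m)"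
    by (simp add: qpoch_Suc mult_ac)
  finally show ?case .
qed

section \<open>Specialisation to the coefficients of the two series\<close>

text \<open>
  The product vanishes for \<open>k > N\<close> because of the factor with \<open>l = N\<close>. This is what cuts the
  Saalschuetz sum off at \<open>k = min N m\<close>, in agreement with the condition \<open>i = N - k \<ge> 0\<close>.
\<close>

lemma prod_power_diff:
  fixes q :: complex
  assumes nr: "\<And>n. n > 0 \<Longrightarrow> q ^ n \<noteq> 1"
  shows "(\<Prod>l<k. q ^ N - q ^ l) =
    (if k \<le> N then (- 1) ^ k * q ^ (k * (k - 1) div 2) * qpoch q q N / qpoch q q (N - k) else 0)"
proof (cases "k \<le> N")
  case True
  then show ?thesis
  proof (induction k)
    case 0
    then show ?case by (simp add: qpoch_q_nonzero[OF nr])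
  next
    case (Suc k)
    then obtain r where r: "N = Suc (k + r)"
      using less_eq_Suc_le less_imp_Suc_add by blast
    have tri: "Suc k * k div 2 = k * (k - 1) div 2 + k"
      by (cases k) simp_all
    have "1 - q * q ^ r \<noteq> 0" using nr[of "Suc r"] by simp
    moreover have "qpoch q q r \<noteq> 0" by (rule qpoch_q_nonzero[OF nr])
    moreover have "q ^ N - q ^ k = - (q ^ k * (1 - q * q ^ r))"
      by (simp add: r power_add algebra_simps)
    moreover have "N - k = Suc r" "N - Suc k = r" using r by simp_all
    ultimately show ?case
      using Suc by (simp add: tri power_add qpoch_Suc del: mult_Suc)
  qed
next
  case False
  then show ?thesis by (auto intro!: prod_zero)
qed

text \<open>
  The power \<open>q\<^bsup>i j\<^esup>\<close> of the double series is what clears the negative powers of \<open>q\<close> in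
  \<open>(b q\<^bsup>-i\<^esup>; q)\<^sub>j\<close>.
\<close>

lemma qpoch_base_inverse:
  assumes "q \<noteq> 0"
  shows "q ^ (N * m) * qpoch (b / q ^ N) q m = (\<Prod>l<m. q ^ N - b * q ^ l)"
proof -
  have "q ^ (N * m) * qpoch (b / q ^ N) q m = (\<Prod>l<m. q ^ N * (1 - b / q ^ N * q ^ l))"
    by (simp add: qpoch_def prod.distrib power_mult)
  also have "\<dots> = (\<Prod>l<m. q ^ N - b * q ^ l)"
    using assms by (simp add: right_diff_distrib)
  finally show ?thesis .
qed

text \<open>
  This is \<open>q_saalschuetz\<close> at \<open>y = q\<^sup>N\<close>, divided by \<open>(q; q)\<^sub>N (b t; q)\<^sub>m\<close>, with the order of
  summation reversed.
\<close>

lemma saalschuetz_coefficient: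
  assumes q0: "q \<noteq> 0" and nr: "\<And>n. n > 0 \<Longrightarrow> q ^ n \<noteq> 1"
    and bt: "\<And>n. 1 - b * t * q ^ n \<noteq> 0"
  shows "q ^ (N * m) / (qpoch q q N * qpoch q q m)
          * (qpoch (b / q ^ N) q m * qpoch t q m / qpoch (b * t) q m)
      = (\<Sum>k\<le>min N m. q ^ (k * (k - 1) div 2) * (- 1) ^ k
            / (qpoch q q (N - k) * qpoch q q (m - k) * qpoch q q k)
            * (qpoch (t * q ^ N) q (m - k) * qpoch b q (m - k) / qpoch (b * t) q (m - k)))"
proof -
  let ?s = "\<lambda>k. q ^ (k * (k - 1) div 2) * (- 1) ^ k
            / (qpoch q q (N - k) * qpoch q q (m - k) * qpoch q q k)
            * (qpoch (t * q ^ N) q (m - k) * qpoch b q (m - k) / qpoch (b * t) q (m - k))"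
  have nz: "qpoch q q n \<noteq> 0" "qpoch (b * t) q n \<noteq> 0" for n
    using qpoch_q_nonzero[OF nr] bt by (simp_all add: qpoch_def)
  have term_eq: "saal_term q b t (q ^ N) (m - k) k / (qpoch q q N * qpoch (b * t) q m)
      = (if k \<le> N then ?s k else 0)" if "k \<le> m" for k
  proof -
    have "qpoch (b * t) q m = qpoch (b * t) q (m - k) * qpoch (b * t * q ^ (m - k)) q k"
      using qpoch_add[of "b * t" q "m - k" k] that by simp
    moreover from this have "qpoch (b * t * q ^ (m - k)) q k \<noteq> 0"
      using nz(2)[of m] by auto
    ultimately show ?thesis
      using nz(1)[of N] by (simp add: saal_term_def prod_power_diff[OF nr] mult_ac)
  qed
  have "q ^ (N * m) / (qpoch q q N * qpoch q q m)
          * (qpoch (b / q ^ N) q m * qpoch t q m / qpoch (b * t) q m)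
      = (\<Sum>j\<le>m. saal_term q b t (q ^ N) j (m - j)) / (qpoch q q N * qpoch (b * t) q m)"
    by (simp add: q_saalschuetz[OF nr] qpoch_base_inverse[OF q0, symmetric] mult_ac)
  also have "(\<Sum>j\<le>m. saal_term q b t (q ^ N) j (m - j)) = (\<Sum>k\<le>m. saal_term q b t (q ^ N) (m - k) k)"
    by (rule sum.reindex_bij_witness[of _ "\<lambda>k. m - k" "\<lambda>k. m - k"]) auto
  also have "\<dots> / (qpoch q q N * qpoch (b * t) q m) = (\<Sum>k\<le>m. if k \<le> N then ?s k else 0)"
    by (simp add: sum_divide_distrib term_eq)
  also have "\<dots> = (\<Sum>k\<le>min N m. ?s k)"
    by (rule sum.mono_neutral_cong_right) auto
  finally show ?thesis .
qed

section \<open>Regrouping the triple series\<close>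

text \<open>
  The map \<open>(i, j, k) \<mapsto> ((i + k, j + k), k)\<close> is a bijection from all triples onto those
  \<open>((N, m), k)\<close> with \<open>k \<le> min N m\<close>.
\<close>

lemma infsum_by_diagonals:
  fixes f :: "nat \<times> nat \<times> nat \<Rightarrow> 'a::banach"
  assumes "f summable_on UNIV"
  shows "infsum f UNIV = (\<Sum>\<^sub>\<infinity>(N, m)\<in>UNIV. \<Sum>k\<le>min N m. f (N - k, m - k, k))"
proof -
  let ?S = "Sigma UNIV (\<lambda>(N::nat, m::nat). {..min N m})"
  let ?g = "\<lambda>((N, m), k). (N - k, m - k, k)"
  have bij: "bij_betw ?g ?S UNIV"
    by (rule bij_betwI[of _ _ _ "\<lambda>(i, j, k). ((i + k, j + k), k)"]) auto
  have "(\<lambda>z. f (?g z)) summable_on ?S"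
    using assms summable_on_reindex_bij_betw[OF bij] by blast
  then have "infsum (\<lambda>z. f (?g z)) ?S = (\<Sum>\<^sub>\<infinity>p. \<Sum>\<^sub>\<infinity>k\<in>(case p of (N, m) \<Rightarrow> {..min N m}). f (?g (p, k)))"
    by (rule infsum_Sigma_banach[symmetric])
  also have "\<dots> = (\<Sum>\<^sub>\<infinity>(N, m)\<in>UNIV. \<Sum>k\<le>min N m. f (N - k, m - k, k))"
    by (intro infsum_cong) (auto split: prod.splits)
  finally show ?thesis
    using infsum_reindex_bij_betw[OF bij, of f] by simp
qed

theorem theorem1p3:
  fixes A :: "int \<Rightarrow> complex" and q x b t :: complex
  assumes q: "0 < norm q" "norm q < 1"
    and denom: "\<And>m::nat. 1 - b * t * q ^ m \<noteq> 0"
    and conv_lhs: "(\<lambda>(i::nat, j::nat).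
          A (int i - int j) * q ^ (i * j) * x ^ j / (qpoch q q i * qpoch q q j)
            * (qpoch (b / q ^ i) q j * qpoch t q j / qpoch (b * t) q j)) abs_summable_on UNIV"
    and conv_rhs: "(\<lambda>(i::nat, j::nat, k::nat).
          A (int i - int j) * q ^ (k * (k - 1) div 2) * (- 1) ^ k * x ^ (j + k)
            / (qpoch q q i * qpoch q q j * qpoch q q k)
            * (qpoch (t * q ^ (i + k)) q j * qpoch b q j / qpoch (b * t) q j)) abs_summable_on UNIV"
  shows "(\<Sum>\<^sub>\<infinity>(i::nat, j::nat)\<in>UNIV.
          A (int i - int j) * q ^ (i * j) * x ^ j / (qpoch q q i * qpoch q q j)
            * (qpoch (b / q ^ i) q j * qpoch t q j / qpoch (b * t) q j))
       = (\<Sum>\<^sub>\<infinity>(i::nat, j::nat, k::nat)\<in>UNIV.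
          A (int i - int j) * q ^ (k * (k - 1) div 2) * (- 1) ^ k * x ^ (j + k)
            / (qpoch q q i * qpoch q q j * qpoch q q k)
            * (qpoch (t * q ^ (i + k)) q j * qpoch b q j / qpoch (b * t) q j))"
proof -
  have q0: "q \<noteq> 0" using q(1) by auto
  have nr: "q ^ n \<noteq> 1" if "n > 0" for n
  proof
    assume "q ^ n = 1"
    then have "norm q ^ n = 1" by (metis norm_one norm_power)
    moreover have "norm q ^ n < 1" using q that by (simp add: power_less_one_iff)
    ultimately show False by simp
  qed
  let ?f = "\<lambda>(i::nat, j::nat, k::nat).
          A (int i - int j) * q ^ (k * (k - 1) div 2) * (- 1) ^ k * x ^ (j + k)
            / (qpoch q q i * qpoch q q j * qpoch q q k)
            * (qpoch (t * q ^ (i + k)) q j * qpoch b q j / qpoch (b * t) q j)"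
  have "infsum ?f UNIV = (\<Sum>\<^sub>\<infinity>(N, m)\<in>UNIV. \<Sum>k\<le>min N m. ?f (N - k, m - k, k))"
    by (rule infsum_by_diagonals) (rule abs_summable_summable[OF conv_rhs])
  also have "\<dots> = (\<Sum>\<^sub>\<infinity>(i::nat, j::nat)\<in>UNIV.
          A (int i - int j) * q ^ (i * j) * x ^ j / (qpoch q q i * qpoch q q j)
            * (qpoch (b / q ^ i) q j * qpoch t q j / qpoch (b * t) q j))"
  proof (rule infsum_cong)
    fix p :: "nat \<times> nat"
    obtain N m where p: "p = (N, m)" by (cases p)
    let ?s = "\<lambda>k. q ^ (k * (k - 1) div 2) * (- 1) ^ k
            / (qpoch q q (N - k) * qpoch q q (m - k) * qpoch q q k)
            * (qpoch (t * q ^ N) q (m - k) * qpoch b q (m - k) / qpoch (b * t) q (m - k))"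
    have "?f (N - k, m - k, k) = A (int N - int m) * x ^ m * ?s k" if "k \<le> min N m" for k
    proof -
      have "int (N - k) - int (m - k) = int N - int m" "m - k + k = m" "N - k + k = N"
        using that by auto
      then show ?thesis by (simp add: mult_ac)
    qed
    then have "(\<Sum>k\<le>min N m. ?f (N - k, m - k, k)) = A (int N - int m) * x ^ m * (\<Sum>k\<le>min N m. ?s k)"
      unfolding sum_distrib_left by (intro sum.cong) auto
    also have "(\<Sum>k\<le>min N m. ?s k) = q ^ (N * m) / (qpoch q q N * qpoch q q m)
          * (qpoch (b / q ^ N) q m * qpoch t q m / qpoch (b * t) q m)"
      by (rule saalschuetz_coefficient[OF q0 nr denom, symmetric])
    also have "A (int N - int m) * x ^ m * \<dots>
        = A (int N - int m) * q ^ (N * m) * x ^ m / (qpoch q q N * qpoch q q m)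
            * (qpoch (b / q ^ N) q m * qpoch t q m / qpoch (b * t) q m)"
      by simp
    finally show "(case p of (N, m) \<Rightarrow> \<Sum>k\<le>min N m. ?f (N - k, m - k, k)) =
        (case p of (i, j) \<Rightarrow> A (int i - int j) * q ^ (i * j) * x ^ j / (qpoch q q i * qpoch q q j)
            * (qpoch (b / q ^ i) q j * qpoch t q j / qpoch (b * t) q j))"
      by (simp only: p prod.case)
  qed
  finally show ?thesis by simp
qed

end
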